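(* Let $A,B\in\mathbb{C}^{n\times n}$ be such that for each $i\in\{1,\dots,n\}$ the $i$th row of at least one of $A$ and $B$ is strictly diagonally dominant. Then $K(A,B)\subseteq\Gamma(A,B)$, where $K(A,B)$ and $\Gamma(A,B)$ are the sets defined in the context.
   Context: Write $A=(a_{i,j})$, $B=(b_{i,j})$. The $i$th row of a matrix $M=(m_{i,j})$ is strictly diagonally dominant if $|m_{i,i}|>\sum_{j\ne i}|m_{i,j}|$. $K(A,B)=\bigcup_{i=1}^nK_i(A,B)$, where $K_i(A,B)=\{z\in\mathbb{C}:|b_{i,i}z-a_{i,i}|\le\sum_{j\ne i}|b_{i,j}z-a_{i,j}|\}$. $\Gamma(A,B)=\bigcup_{i=1}^n\Gamma_i(A,B)$ with $\Gamma_i(A,B)=\Gamma_i^B(A,B)\cap\Gamma_i^A(A,B)$, subsets of $\mathbb{C}\cup\{\infty\}$ defined as follows. Let $S^B$ (resp. $S^A$) be the set of $i$ such that the $i$th row of $B$ (resp. $A$) is strictly diagonally dominant. For $i\in S^B$ let $r_i=\sum_{j\ne i}|b_{i,j}|/|b_{i,i}|\;(<1)$, $R_i=\sum_{j\neq i}|a_{i,j}|$, $\rho_i=\frac{|a_{i,i}|r_i+R_i}{|b_{i,i}|(1-r_i)}$, and $\Gamma_i^B(A,B)=\{z\in\mathbb{C}:|z-a_{i,i}/b_{i,i}|\le\rho_i\}$. For $i\notin S^B$, $\Gamma_i^B(A,B)$ is the whole plane, including $\infty$. For $i\in S^A$ let $r_i^A=\sum_{j\ne i}|a_{i,j}|/|a_{i,i}|\;(<1)$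 and $R_i^A=\sum_{j\ne i}|b_{i,j}|$. If $b_{i,i}=R_i^A=0$, then $\Gamma_i^A(A,B)=\{\infty\}$. If $b_{i,i}=0$ and $R_i^A>0$, then $\Gamma_i^A(A,B)=\{z\in\mathbb{C}:|z|\ge\frac{|a_{i,i}|}{R_i^A}(1-r_i^A)\}\cup\{\infty\}$. If $b_{i,i}\ne0$, let $\alpha_i=\frac{a_{i,i}}{b_{i,i}}$, $\beta_i=\frac{|b_{i,i}|r_i^A+R_i^A}{|b_{i,i}|(1-r_i^A)}$ and, when $\beta_i\neq1$, $c_i=\frac{\alpha_i}{1-\beta_i^2}$, $\rho_i^A=\frac{|\alpha_i|\beta_i}{|1-\beta_i^2|}$; then $\Gamma_i^A(A,B)$ is $\{z\in\mathbb{C}:|z-c_i|\le\rho_i^A\}$ if $\beta_i<1$, $\{z\in\mathbb{C}:|z-c_i|\ge\rho_i^A\}\cup\{\infty\}$ if $\beta_i>1$, and $\{z\in\mathbb{C}:|z-\alpha_i|\le|z|\}\cup\{\infty\}$ if $\beta_i=1$. For $i\notin S^A$, $\Gamma_i^A(A,B)$ is the whole plane, including $\infty$. *)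

theory Defs
  imports "HOL-Analysis.Analysis"
begin

text \<open>The extended complex plane, with \<open>Some z\<close> for a finite point and \<open>None\<close> for the point at
  infinity; this is the point set of \<^const>\<open>Alexandroff_compactification\<close> on \<^typ>\<open>complex\<close>.\<close>

type_synonym ext_complex = "complex option"

definition offdiag_sum :: "complex^'n^'n \<Rightarrow> 'n \<Rightarrow> real" where
  "offdiag_sum M i = (\<Sum>j\<in>UNIV - {i}. cmod (M $ i $ j))"

definition row_sdd :: "complex^'n^'n \<Rightarrow> 'n \<Rightarrow> bool" where
  "row_sdd M i \<longleftrightarrow> cmod (M $ i $ i) > offdiag_sum M i"

definition K_row :: "complex^'n^'n \<Rightarrow> complex^'n^'n \<Rightarrow> 'n \<Rightarrow> complex set" where
  "K_row A B i = {z. cmod (B $ i $ i * z - A $ i $ i)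
                     \<le> (\<Sum>j\<in>UNIV - {i}. cmod (B $ i $ j * z - A $ i $ j))}"

definition K_set :: "complex^'n^'n \<Rightarrow> complex^'n^'n \<Rightarrow> complex set" where
  "K_set A B = (\<Union>i\<in>UNIV. K_row A B i)"

text \<open>Used as \<open>r\<^sub>i = diag_ratio B i\<close> and \<open>r\<^sub>i\<^sup>A = diag_ratio A i\<close>, only for strictly diagonally
  dominant rows, whose diagonal entry is nonzero.\<close>

definition diag_ratio :: "complex^'n^'n \<Rightarrow> 'n \<Rightarrow> real" where
  "diag_ratio M i = offdiag_sum M i / cmod (M $ i $ i)"

definition rho_B :: "complex^'n^'n \<Rightarrow> complex^'n^'n \<Rightarrow> 'n \<Rightarrow> real" where
  "rho_B A B i = (cmod (A $ i $ i) * diag_ratio B i + offdiag_sum A i)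
                 / (cmod (B $ i $ i) * (1 - diag_ratio B i))"

definition Gamma_B :: "complex^'n^'n \<Rightarrow> complex^'n^'n \<Rightarrow> 'n \<Rightarrow> ext_complex set" where
  "Gamma_B A B i =
     (if row_sdd B i then Some ` {z. cmod (z - A $ i $ i / B $ i $ i) \<le> rho_B A B i} else UNIV)"

definition alpha :: "complex^'n^'n \<Rightarrow> complex^'n^'n \<Rightarrow> 'n \<Rightarrow> complex" where
  "alpha A B i = A $ i $ i / B $ i $ i"

definition beta :: "complex^'n^'n \<Rightarrow> complex^'n^'n \<Rightarrow> 'n \<Rightarrow> real" where
  "beta A B i = (cmod (B $ i $ i) * diag_ratio A i + offdiag_sum B i)
                / (cmod (B $ i $ i) * (1 - diag_ratio A i))"

definition center_A :: "complex^'n^'n \<Rightarrow> complex^'n^'n \<Rightarrow> 'n \<Rightarrow> complex" where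
  "center_A A B i = alpha A B i / of_real (1 - (beta A B i)\<^sup>2)"

definition rho_A :: "complex^'n^'n \<Rightarrow> complex^'n^'n \<Rightarrow> 'n \<Rightarrow> real" where
  "rho_A A B i = cmod (alpha A B i) * beta A B i / \<bar>1 - (beta A B i)\<^sup>2\<bar>"

text \<open>The second branch is the case \<open>b\<^sub>i\<^sub>i = 0\<close>, \<open>R\<^sub>i\<^sup>A > 0\<close>, since \<open>offdiag_sum B i \<ge> 0\<close>;
  the last one is \<open>\<beta>\<^sub>i = 1\<close>.\<close>

definition Gamma_A :: "complex^'n^'n \<Rightarrow> complex^'n^'n \<Rightarrow> 'n \<Rightarrow> ext_complex set" where
  "Gamma_A A B i =
     (if \<not> row_sdd A i then UNIV
      else if B $ i $ i = 0 \<and> offdiag_sum B i = 0 then {None}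
      else if B $ i $ i = 0 then
        insert None (Some ` {z. cmod z \<ge> cmod (A $ i $ i) / offdiag_sum B i * (1 - diag_ratio A i)})
      else if beta A B i < 1 then
        Some ` {z. cmod (z - center_A A B i) \<le> rho_A A B i}
      else if beta A B i > 1 then
        insert None (Some ` {z. cmod (z - center_A A B i) \<ge> rho_A A B i})
      else
        insert None (Some ` {z. cmod (z - alpha A B i) \<le> cmod z}))"

definition Gamma_row :: "complex^'n^'n \<Rightarrow> complex^'n^'n \<Rightarrow> 'n \<Rightarrow> ext_complex set" where
  "Gamma_row A B i = Gamma_B A B i \<inter> Gamma_A A B i"

definition Gamma_set :: "complex^'n^'n \<Rightarrow> complex^'n^'n \<Rightarrow> ext_complex set" where
  "Gamma_set A B = (\<Union>i\<in>UNIV. Gamma_row A B i)"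

end

theory Submission
  imports Defs
begin

text \<open>With \<open>S\<^sub>A\<close>, \<open>S\<^sub>B\<close> the off-diagonal row sums, membership in a row of \<open>K\<close> gives
  \<open>|b z - a| \<le> |z| S\<^sub>B + S\<^sub>A\<close>. If the row of \<open>B\<close> is dominant, insert \<open>|z| \<le> |z - a/b| + |a/b|\<close>
  and solve for \<open>|z - a/b|\<close>. If the row of \<open>A\<close> is dominant, write \<open>S\<^sub>A = r |a|\<close>, insert
  \<open>|a| \<le> |b z - a| + |b z|\<close> and solve for \<open>|b z - a|\<close>; for \<open>b \<noteq> 0\<close> this is
  \<open>|z - \<alpha>| \<le> \<beta> |z|\<close>, whose solution set is one side of a circle of Apollonius.\<close>

lemma offdiag_sum_nonneg: "0 \<le> offdiag_sum M i"
  unfolding offdiag_sum_def by (simp add: sum_nonneg)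

lemma diag_ratio_nonneg: "0 \<le> diag_ratio M i"
  unfolding diag_ratio_def by (simp add: offdiag_sum_nonneg)

lemma row_sdd_diag_nonzero: "row_sdd M i \<Longrightarrow> M $ i $ i \<noteq> 0"
  unfolding row_sdd_def using offdiag_sum_nonneg[of M i] by auto

lemma row_sdd_diag_ratio_less_1:
  assumes "row_sdd M i"
  shows "diag_ratio M i < 1"
  using assms row_sdd_diag_nonzero[OF assms] unfolding row_sdd_def diag_ratio_def by simp

lemma offdiag_sum_eq_diag_ratio:
  assumes "row_sdd M i"
  shows "offdiag_sum M i = diag_ratio M i * cmod (M $ i $ i)"
  using row_sdd_diag_nonzero[OF assms] unfolding diag_ratio_def by simp

text \<open>The triangle inequality, applied to each off-diagonal term. From here on a row of
  \<open>K\<close> enters only through the two diagonal entries and the two row sums.\<close>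

lemma K_row_bound:
  assumes "z \<in> K_row A B i"
  shows "cmod (B $ i $ i * z - A $ i $ i) \<le> cmod z * offdiag_sum B i + offdiag_sum A i"
proof -
  have "cmod (B $ i $ i * z - A $ i $ i)
      \<le> (\<Sum>j\<in>UNIV - {i}. cmod (B $ i $ j * z - A $ i $ j))"
    using assms unfolding K_row_def by simp
  also have "\<dots> \<le> (\<Sum>j\<in>UNIV - {i}. cmod z * cmod (B $ i $ j) + cmod (A $ i $ j))"
    by (intro sum_mono) (metis mult.commute norm_mult norm_triangle_ineq4)
  also have "\<dots> = cmod z * offdiag_sum B i + offdiag_sum A i"
    unfolding offdiag_sum_def by (simp add: sum.distrib sum_distrib_left)
  finally show ?thesis .
qed

lemma K_row_Gamma_B:
  assumes z: "z \<in> K_row A B i"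
  shows "Some z \<in> Gamma_B A B i"
proof (cases "row_sdd B i")
  case False
  then show ?thesis unfolding Gamma_B_def by simp
next
  case True
  define a where "a = A $ i $ i"
  define b where "b = B $ i $ i"
  define r where "r = diag_ratio B i"
  define w where "w = cmod (z - a / b)"
  have b: "b \<noteq> 0"
    unfolding b_def by (rule row_sdd_diag_nonzero[OF True])
  have r: "0 \<le> r" "r < 1"
    unfolding r_def by (rule diag_ratio_nonneg, rule row_sdd_diag_ratio_less_1[OF True])
  have S: "offdiag_sum B i = r * cmod b"
    unfolding b_def r_def by (rule offdiag_sum_eq_diag_ratio[OF True])
  have "b * z - a = b * (z - a / b)"
    using b by (simp add: field_simps)
  then have "cmod b * w = cmod (b * z - a)"
    unfolding w_def by (simp add: norm_mult)
  also have "\<dots> \<le> r * (cmod b * cmod z) + offdiag_sum A i"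
    using K_row_bound[OF z] unfolding a_def[symmetric] b_def[symmetric] S
    by (simp add: mult_ac)
  \<comment> \<open>Trading |z| for \<open>w\<close> makes the unknown reappear on the right with
    coefficient r |b|; since r < 1, it can be absorbed on the left.\<close>
  also have "\<dots> \<le> r * (cmod b * w + cmod a) + offdiag_sum A i"
  proof -
    have "cmod z \<le> w + cmod (a / b)"
      unfolding w_def using norm_triangle_ineq[of "z - a / b" "a / b"] by simp
    then have "cmod b * cmod z \<le> cmod b * (w + cmod (a / b))"
      by (intro mult_left_mono) auto
    also have "\<dots> = cmod b * w + cmod a"
      using b by (simp add: norm_divide distrib_left)
    finally show ?thesis
      using r(1) by (intro add_right_mono mult_left_mono)
  qed
  finally have "w * (cmod b * (1 - r)) \<le> cmod a * r + offdiag_sum A i"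
    by (simp add: algebra_simps)
  then have "w \<le> rho_B A B i"
    unfolding rho_B_def a_def[symmetric] b_def[symmetric] r_def[symmetric]
    using b r by (subst pos_le_divide_eq) auto
  then show ?thesis
    using True unfolding Gamma_B_def w_def a_def b_def by simp
qed

text \<open>Completing the square. The factor \<open>d\<^sup>2\<close> clears denominators without
  affecting signs, so the sign of \<open>d\<close> on the right alone decides between the inside and
  the outside of the circle.\<close>

lemma apollonius_identity:
  fixes z \<alpha> :: complex and d \<beta> :: real
  assumes "d = 1 - \<beta>\<^sup>2" and "d \<noteq> 0"
  shows "d\<^sup>2 * ((cmod (z - \<alpha> / of_real d))\<^sup>2 - (cmod \<alpha> * \<beta> / \<bar>d\<bar>)\<^sup>2)
           = d * ((cmod (z - \<alpha>))\<^sup>2 - (\<beta> * cmod z)\<^sup>2)"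
proof -
  have "d\<^sup>2 * (cmod (z - \<alpha> / of_real d))\<^sup>2 = (cmod (of_real d * z - \<alpha>))\<^sup>2"
  proof -
    have "of_real d * z - \<alpha> = of_real d * (z - \<alpha> / of_real d)"
      using assms(2) by (simp add: field_simps)
    then show ?thesis by (simp add: norm_mult power_mult_distrib)
  qed
  moreover have "d\<^sup>2 * (cmod \<alpha> * \<beta> / \<bar>d\<bar>)\<^sup>2 = (cmod \<alpha>)\<^sup>2 * \<beta>\<^sup>2"
    using assms(2) by (simp add: power_divide power_mult_distrib)
  \<comment> \<open>After expansion, the terms in |z|^2 and |\<alpha>|^2 match because d = 1 -
    \<beta>^2; the cross term carries a factor d on both sides.\<close>
  moreover have "(cmod (of_real d * z - \<alpha>))\<^sup>2 - (cmod \<alpha>)\<^sup>2 * \<beta>\<^sup>2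
      = d * ((cmod (z - \<alpha>))\<^sup>2 - (\<beta> * cmod z)\<^sup>2)"
    unfolding cmod_power2 power_mult_distrib assms(1)
    by (simp add: algebra_simps power2_eq_square)
  ultimately show ?thesis
    by (simp only: right_diff_distrib)
qed

text \<open>Here d > 0, so \<open>apollonius_identity\<close> preserves the direction of the
  inequality.\<close>

lemma apollonius_inside:
  fixes z \<alpha> :: complex and \<beta> :: real
  assumes "cmod (z - \<alpha>) \<le> \<beta> * cmod z" and "0 \<le> \<beta>" "\<beta> < 1"
  shows "cmod (z - \<alpha> / of_real (1 - \<beta>\<^sup>2)) \<le> cmod \<alpha> * \<beta> / \<bar>1 - \<beta>\<^sup>2\<bar>"
proof -
  define d where "d = 1 - \<beta>\<^sup>2"
  have d: "d > 0" using assms(2,3) unfolding d_def by (simp add: power2_less_1_iff)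
  have "(cmod (z - \<alpha>))\<^sup>2 \<le> (\<beta> * cmod z)\<^sup>2"
    using assms(1) by (simp add: power_mono)
  then have "d\<^sup>2 * ((cmod (z - \<alpha> / of_real d))\<^sup>2 - (cmod \<alpha> * \<beta> / \<bar>d\<bar>)\<^sup>2) \<le> 0"
    using d by (subst apollonius_identity[OF d_def]) (auto simp: mult_le_0_iff)
  then have "(cmod (z - \<alpha> / of_real d))\<^sup>2 \<le> (cmod \<alpha> * \<beta> / \<bar>d\<bar>)\<^sup>2"
    using d by (simp add: mult_le_0_iff)
  then show ?thesis
    unfolding d_def[symmetric] by (rule power2_le_imp_le) (simp add: assms(2))
qed

text \<open>Here d < 0, so \<open>apollonius_identity\<close> reverses the inequality.\<close>

lemma apollonius_outside:
  fixes z \<alpha> :: complex and \<beta> :: real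
  assumes "cmod (z - \<alpha>) \<le> \<beta> * cmod z" and "1 < \<beta>"
  shows "cmod \<alpha> * \<beta> / \<bar>1 - \<beta>\<^sup>2\<bar> \<le> cmod (z - \<alpha> / of_real (1 - \<beta>\<^sup>2))"
proof -
  define d where "d = 1 - \<beta>\<^sup>2"
  have d: "d < 0" using assms(2) unfolding d_def by simp
  have "(cmod (z - \<alpha>))\<^sup>2 \<le> (\<beta> * cmod z)\<^sup>2"
    using assms(1) by (simp add: power_mono)
  then have "0 \<le> d\<^sup>2 * ((cmod (z - \<alpha> / of_real d))\<^sup>2 - (cmod \<alpha> * \<beta> / \<bar>d\<bar>)\<^sup>2)"
    using d by (subst apollonius_identity[OF d_def]) (auto simp: zero_le_mult_iff)
  then have "(cmod \<alpha> * \<beta> / \<bar>d\<bar>)\<^sup>2 \<le> (cmod (z - \<alpha> / of_real d))\<^sup>2"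
    using d by (simp add: zero_le_mult_iff)
  then show ?thesis
    unfolding d_def[symmetric] by (rule power2_le_imp_le) simp
qed

text \<open>Kept free of division by the diagonal entry of \<open>B\<close>, so that it serves both
  when that entry vanishes and when it does not.\<close>

lemma K_row_dominant_A:
  assumes z: "z \<in> K_row A B i" and A: "row_sdd A i"
  shows "(1 - diag_ratio A i) * cmod (B $ i $ i * z - A $ i $ i)
           \<le> cmod z * (cmod (B $ i $ i) * diag_ratio A i + offdiag_sum B i)"
proof -
  let ?a = "A $ i $ i" and ?b = "B $ i $ i" and ?r = "diag_ratio A i"
  have "cmod (?b * z - ?a) \<le> cmod z * offdiag_sum B i + ?r * cmod ?a"
    using K_row_bound[OF z] offdiag_sum_eq_diag_ratio[OF A] by simp
  also have "\<dots> \<le> cmod z * offdiag_sum B i + ?r * (cmod (?b * z - ?a) + cmod ?b * cmod z)"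
  proof -
    have "cmod ?a \<le> cmod (?b * z - ?a) + cmod ?b * cmod z"
      using norm_triangle_sub[of ?a "?b * z"] by (simp add: norm_minus_commute norm_mult)
    then show ?thesis
      by (intro add_left_mono mult_left_mono diag_ratio_nonneg)
  qed
  finally show ?thesis by (simp add: algebra_simps)
qed

lemma beta_nonneg:
  assumes "row_sdd A i"
  shows "0 \<le> beta A B i"
  using row_sdd_diag_ratio_less_1[OF assms] diag_ratio_nonneg[of A i] offdiag_sum_nonneg[of B i]
  unfolding beta_def by simp

text \<open>Dividing \<open>K_row_dominant_A\<close> by the square of |b|, up to one factor |b| from
  b z - a = b (z - \<alpha>), and by 1 - r > 0 leaves exactly the quotient
  \<open>beta\<close>.\<close>

lemma K_row_alpha_beta:
  assumes z: "z \<in> K_row A B i" and A: "row_sdd A i" and b: "B $ i $ i \<noteq> 0"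
  shows "cmod (z - alpha A B i) \<le> beta A B i * cmod z"
proof -
  have "B $ i $ i * z - A $ i $ i = B $ i $ i * (z - alpha A B i)"
    using b unfolding alpha_def by (simp add: field_simps)
  then have "cmod (z - alpha A B i) * (cmod (B $ i $ i) * (1 - diag_ratio A i))
      \<le> (cmod (B $ i $ i) * diag_ratio A i + offdiag_sum B i) * cmod z"
    using K_row_dominant_A[OF z A] by (simp add: norm_mult mult_ac)
  then show ?thesis
    using b row_sdd_diag_ratio_less_1[OF A] unfolding beta_def
    by (simp add: pos_le_divide_eq)
qed

lemma K_row_Gamma_A:
  assumes z: "z \<in> K_row A B i"
  shows "Some z \<in> Gamma_A A B i"
proof (cases "row_sdd A i")
  case False
  then show ?thesis unfolding Gamma_A_def by simp
next
  case A: True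
  show ?thesis
  proof (cases "B $ i $ i = 0")
    case b: True
    have *: "(1 - diag_ratio A i) * cmod (A $ i $ i) \<le> cmod z * offdiag_sum B i"
      using K_row_dominant_A[OF z A] b by simp
    \<comment> \<open>This positivity excludes a zero row sum of \<open>B\<close>: no finite point
      reaches the branch where only infinity remains.\<close>
    have "0 < (1 - diag_ratio A i) * cmod (A $ i $ i)"
      using row_sdd_diag_ratio_less_1[OF A] row_sdd_diag_nonzero[OF A] by simp
    with * have "offdiag_sum B i \<noteq> 0" by auto
    moreover from this have "cmod (A $ i $ i) / offdiag_sum B i * (1 - diag_ratio A i) \<le> cmod z"
      using * offdiag_sum_nonneg[of B i] by (simp add: pos_divide_le_eq mult_ac)
    ultimately show ?thesis
      using A b unfolding Gamma_A_def by simp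
  next
    case b: False
    note ab = K_row_alpha_beta[OF z A b]
    consider "beta A B i < 1" | "beta A B i > 1" | "beta A B i = 1" by linarith
    then show ?thesis
    proof cases
      case 1
      then show ?thesis
        using A b apollonius_inside[OF ab beta_nonneg[OF A]]
        unfolding Gamma_A_def center_A_def rho_A_def by simp
    next
      case 2
      then show ?thesis
        using A b apollonius_outside[OF ab]
        unfolding Gamma_A_def center_A_def rho_A_def by simp
    next
      \<comment> \<open>The circle degenerates to the perpendicular bisector of 0 and \<alpha>, and
        the bound \<open>ab\<close> is already the half-plane condition.\<close>
      case 3
      then show ?thesis
        using A b ab unfolding Gamma_A_def by simp
    qed
  qed
qed

theorem mainTheorem6:
  fixes A B :: "complex^'n^'n"
  assumes "\<And>i. row_sdd A i \<or> row_sdd B i"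
  shows "Some ` K_set A B \<subseteq> Gamma_set A B"
proof clarify
  fix z assume "z \<in> K_set A B"
  then obtain i where "z \<in> K_row A B i"
    unfolding K_set_def by blast
  then have "Some z \<in> Gamma_row A B i"
    unfolding Gamma_row_def by (intro IntI K_row_Gamma_A K_row_Gamma_B)
  then show "Some z \<in> Gamma_set A B"
    unfolding Gamma_set_def by blast
qed

end
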